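(* Let $D$ be an infinite set and let $\kappa$ be a cardinal with $1\leq\kappa\leq|D|$. Let $Q^{\geq\kappa}=\{A\subseteq D:|A|\geq\kappa\}$. For every proper upward monotone quantifier $P$ on $D$, $$P\text{ dominates }Q^{\geq\kappa}\quad\text{if and only if}\quad P=\exists_S\text{ for some nonempty }S\subseteq D.$$ When these conditions hold, $$P\cdot Q^{\geq\kappa}=P\boxtimes Q^{\geq\kappa}.$$
   Context: A (unary) quantifier on a nonempty set $D$ is a family $Q\subseteq\mathcal P(D)$. It is upward monotone if $A\in Q$ and $A\subseteq B\subseteq D$ imply $B\in Q$; it is proper if $\varnothing\notin Q$ and $D\in Q$. For $S\subseteq D$, $\exists_S=\{B\subseteq D:S\cap B\neq\varnothing\}$. For $R\subseteq D^2$ put $R_x=\{y\in D:(x,y)\in R\}$ and $R^{-1}=\{(y,x):(x,y)\in R\}$. The iteration is $P\cdot Q=\{R\subseteq D^2:\{x\in D:R_x\in Q\}\in P\}$. $P$ dominates $Q$ if for every $R\subseteq D^2$, $R\in P\cdot Q$ implies $R^{-1}\in Q\cdot P$. The branching product is $P\boxtimes Q=\{R\subseteq D^2:\exists A\in P\ \exists B\in Q\ (A\times B\subseteq R)\}$. *)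

theory Defs
  imports Main
begin

unbundle cardinal_syntax

definition quantifier_on :: "'a set \<Rightarrow> 'a set set \<Rightarrow> bool" where
  "quantifier_on D Q \<longleftrightarrow> Q \<subseteq> Pow D"

definition upward_monotone :: "'a set \<Rightarrow> 'a set set \<Rightarrow> bool" where
  "upward_monotone D Q \<longleftrightarrow> (\<forall>A B. A \<in> Q \<longrightarrow> A \<subseteq> B \<longrightarrow> B \<subseteq> D \<longrightarrow> B \<in> Q)"

definition proper_quantifier :: "'a set \<Rightarrow> 'a set set \<Rightarrow> bool" where
  "proper_quantifier D Q \<longleftrightarrow> {} \<notin> Q \<and> D \<in> Q"

definition exists_in :: "'a set \<Rightarrow> 'a set \<Rightarrow> 'a set set" where
  "exists_in D S = {B. B \<subseteq> D \<and> S \<inter> B \<noteq> {}}"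

text \<open>A cardinal is represented by a cardinal order \<open>\<kappa>\<close>, and \<open>|A|\<close> is the
  cardinal order of the set \<open>A\<close>. The order \<open>\<kappa>\<close> may live on a type other than
  that of the elements of \<open>D\<close>; it matters only up to order isomorphism.\<close>

definition at_least :: "'a set \<Rightarrow> 'b rel \<Rightarrow> 'a set set" where
  "at_least D \<kappa> = {A. A \<subseteq> D \<and> \<kappa> \<le>o |A|}"

text \<open>For \<open>R \<subseteq> D \<times> D\<close>, the section \<open>R\<^sub>x\<close> is the relational image \<open>R `` {x}\<close>.\<close>

definition iteration :: "'a set \<Rightarrow> 'a set set \<Rightarrow> 'a set set \<Rightarrow> 'a rel set" where
  "iteration D P Q = {R. R \<subseteq> D \<times> D \<and> {x \<in> D. R `` {x} \<in> Q} \<in> P}"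

definition dominates :: "'a set \<Rightarrow> 'a set set \<Rightarrow> 'a set set \<Rightarrow> bool" where
  "dominates D P Q \<longleftrightarrow>
    (\<forall>R. R \<subseteq> D \<times> D \<longrightarrow> R \<in> iteration D P Q \<longrightarrow> converse R \<in> iteration D Q P)"

definition branching_product :: "'a set \<Rightarrow> 'a set set \<Rightarrow> 'a set set \<Rightarrow> 'a rel set" where
  "branching_product D P Q = {R. R \<subseteq> D \<times> D \<and> (\<exists>A\<in>P. \<exists>B\<in>Q. A \<times> B \<subseteq> R)}"

end

theory Submission
  imports Defs
begin

text \<open>
  The easy half rests on \<open>\<exists>\<^sub>S\<close> being generated by singletons: a relation \<open>R\<close> in
  \<open>\<exists>\<^sub>S \<cdot> Q\<close> has some row \<open>R\<^sub>s\<close>, with \<open>s \<in> S\<close>, that lies in \<open>Q\<close>. The rectangle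
  \<open>{s} \<times> R\<^sub>s\<close> then witnesses both \<open>R \<in> \<exists>\<^sub>S \<boxtimes> Q\<close> and \<open>R\<inverse> \<in> Q \<cdot> \<exists>\<^sub>S\<close>, for any upward
  monotone \<open>Q\<close>. That \<open>P \<boxtimes> Q\<close> is contained in \<open>P \<cdot> Q\<close> holds for all upward monotone
  quantifiers.

  For the other half, the only candidate for \<open>S\<close> is the set of points whose singleton
  belongs to \<open>P\<close>, and what must be shown is that every \<open>A \<in> P\<close> contains such a point.
  Since \<open>|D| \<cdot> |D| = |D|\<close>, there is room in \<open>D\<close> for pairwise disjoint sets \<open>R\<^sub>x\<close>
  of size \<open>\<kappa>\<close>, one for every \<open>x \<in> A\<close>. The relation with these rows lies in
  \<open>P \<cdot> Q\<^sup>\<ge>\<^sup>\<kappa>\<close>, while each of its columns has at most one element, taken from \<open>A\<close>. Dominance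
  demands at least \<open>\<kappa> \<ge> 1\<close> columns in \<open>P\<close>, and a column in \<open>P\<close> is nonempty because
  \<open>P\<close> is proper, so it is the required singleton.
\<close>

lemma upward_monotone_at_least: "upward_monotone D (at_least D \<kappa>)"
  unfolding upward_monotone_def
proof (intro allI impI)
  fix A B assume "A \<in> at_least D \<kappa>" and AB: "A \<subseteq> B" and "B \<subseteq> D"
  then have "\<kappa> \<le>o |A|" unfolding at_least_def by simp
  then have "\<kappa> \<le>o |B|" using card_of_mono1[OF AB] by (rule ordLeq_transitive)
  with \<open>B \<subseteq> D\<close> show "B \<in> at_least D \<kappa>" unfolding at_least_def by simp
qed

lemma branching_product_subset_iteration:
  assumes "quantifier_on D P" "upward_monotone D P" "upward_monotone D Q"
  shows "branching_product D P Q \<subseteq> iteration D P Q"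
proof
  fix R assume "R \<in> branching_product D P Q"
  then obtain A B where R: "R \<subseteq> D \<times> D" and A: "A \<in> P" and B: "B \<in> Q" and AB: "A \<times> B \<subseteq> R"
    unfolding branching_product_def by blast
  have "R `` {x} \<in> Q" if "x \<in> A" for x
  proof -
    have "B \<subseteq> R `` {x}" "R `` {x} \<subseteq> D" using AB R that by blast+
    then show ?thesis using B assms(3) unfolding upward_monotone_def by blast
  qed
  moreover have "A \<subseteq> D" using A assms(1) unfolding quantifier_on_def by blast
  ultimately have "A \<subseteq> {x \<in> D. R `` {x} \<in> Q}" by blast
  then have "{x \<in> D. R `` {x} \<in> Q} \<in> P"
    using A assms(2) unfolding upward_monotone_def by blast
  with R show "R \<in> iteration D P Q" unfolding iteration_def by blast
qed

lemma upward_monotone_exists_in: "upward_monotone D (exists_in D S)"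
  unfolding upward_monotone_def exists_in_def by blast

lemma iteration_exists_in_row:
  assumes "R \<in> iteration D (exists_in D S) Q"
  obtains s where "s \<in> S" "s \<in> D" "R `` {s} \<in> Q"
  using assms unfolding iteration_def exists_in_def by blast

lemma iteration_exists_in_eq_branching_product:
  assumes "upward_monotone D Q"
  shows "iteration D (exists_in D S) Q = branching_product D (exists_in D S) Q"
proof
  show "iteration D (exists_in D S) Q \<subseteq> branching_product D (exists_in D S) Q"
  proof
    fix R assume R: "R \<in> iteration D (exists_in D S) Q"
    then obtain s where s: "s \<in> S" "s \<in> D" "R `` {s} \<in> Q"
      by (rule iteration_exists_in_row)
    have "{s} \<in> exists_in D S" using s unfolding exists_in_def by blast
    moreover have "{s} \<times> R `` {s} \<subseteq> R" by blast
    ultimately show "R \<in> branching_product D (exists_in D S) Q"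
      using R s(3) unfolding branching_product_def iteration_def by blast
  qed
  have "quantifier_on D (exists_in D S)"
    unfolding quantifier_on_def exists_in_def by blast
  then show "branching_product D (exists_in D S) Q \<subseteq> iteration D (exists_in D S) Q"
    using upward_monotone_exists_in assms by (rule branching_product_subset_iteration)
qed

lemma exists_in_dominates:
  assumes "upward_monotone D Q"
  shows "dominates D (exists_in D S) Q"
  unfolding dominates_def
proof (intro allI impI)
  fix R assume R: "R \<subseteq> D \<times> D" and "R \<in> iteration D (exists_in D S) Q"
  then obtain s where s: "s \<in> S" "R `` {s} \<in> Q"
    by (blast elim: iteration_exists_in_row)
  \<comment> \<open>Every column indexed by an element of the row \<open>R\<^sub>s\<close> contains \<open>s\<close>.\<close>
  have "R `` {s} \<subseteq> {y \<in> D. R\<inverse> `` {y} \<in> exists_in D S}"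
    using R s(1) unfolding exists_in_def by blast
  then have "{y \<in> D. R\<inverse> `` {y} \<in> exists_in D S} \<in> Q"
    using s(2) assms unfolding upward_monotone_def by blast
  then show "R\<inverse> \<in> iteration D Q (exists_in D S)"
    using R unfolding iteration_def by blast
qed

text \<open>
  Split a copy of \<open>D \<times> D\<close> inside \<open>D\<close> into its rows, and keep \<open>\<kappa>\<close> elements of each row
  indexed by \<open>A\<close>.
\<close>

lemma ex_relation_large_rows_singleton_columns:
  assumes "infinite D" "Card_order \<kappa>" "\<kappa> \<le>o |D|" "A \<subseteq> D"
  obtains R where "R \<subseteq> A \<times> D" "\<And>x. x \<in> A \<Longrightarrow> R `` {x} \<in> at_least D \<kappa>"
    "\<And>x x' y. (x, y) \<in> R \<Longrightarrow> (x', y) \<in> R \<Longrightarrow> x = x'"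
proof -
  obtain f where f: "bij_betw f (D \<times> D) D"
    using card_of_Times_same_infinite[OF assms(1)] unfolding card_of_ordIso[symmetric] by blast
  have "|Field \<kappa>| \<le>o |D|"
    using card_of_Field_ordIso[OF assms(2)] assms(3) by (rule ordIso_ordLeq_trans)
  then obtain K where K: "K \<subseteq> D" "|Field \<kappa>| =o |K|"
    unfolding internalize_card_of_ordLeq2[of "Field \<kappa>"] by blast
  have \<kappa>K: "\<kappa> \<le>o |K|"
    using ordIso_symmetric[OF card_of_Field_ordIso[OF assms(2)]] ordIso_imp_ordLeq[OF K(2)]
    by (rule ordIso_ordLeq_trans)
  define R where "R = {(x, f (x, k)) | x k. x \<in> A \<and> k \<in> K}"
  have inj: "inj_on f (D \<times> D)" and im: "f ` (D \<times> D) = D"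
    using f unfolding bij_betw_def by auto
  have R: "R \<subseteq> A \<times> D" using im assms(4) K(1) unfolding R_def by blast
  show thesis
  proof (rule that)
    show "R \<subseteq> A \<times> D" by (rule R)
  next
    fix x assume x: "x \<in> A"
    have "inj_on (\<lambda>k. f (x, k)) K"
      using inj x assms(4) K(1) unfolding inj_on_def by blast
    moreover have "(\<lambda>k. f (x, k)) ` K \<subseteq> R `` {x}" using x unfolding R_def by blast
    ultimately have "|K| \<le>o |R `` {x}|" unfolding card_of_ordLeq[symmetric] by blast
    with \<kappa>K have "\<kappa> \<le>o |R `` {x}|" by (rule ordLeq_transitive)
    then show "R `` {x} \<in> at_least D \<kappa>" using R unfolding at_least_def by blast
  next
    fix x x' y assume "(x, y) \<in> R" "(x', y) \<in> R"
    then obtain k k' where "x \<in> A" "k \<in> K" "x' \<in> A" "k' \<in> K" "f (x, k) = f (x', k')"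
      unfolding R_def by auto
    then have "(x, k) = (x', k')"
      using assms(4) K(1) by (intro inj_onD[OF inj]) auto
    then show "x = x'" by simp
  qed
qed

lemma ex_singleton_in_if_dominates_at_least:
  assumes "infinite D" "Card_order \<kappa>" "|{()}| \<le>o \<kappa>" "\<kappa> \<le>o |D|"
    and P: "quantifier_on D P" "upward_monotone D P" "{} \<notin> P"
    and dom: "dominates D P (at_least D \<kappa>)"
    and A: "A \<in> P"
  shows "\<exists>x\<in>A. {x} \<in> P"
proof -
  have AD: "A \<subseteq> D" using A P(1) unfolding quantifier_on_def by blast
  obtain R where R: "R \<subseteq> A \<times> D" "\<And>x. x \<in> A \<Longrightarrow> R `` {x} \<in> at_least D \<kappa>"
    and uniq: "\<And>x x' y. (x, y) \<in> R \<Longrightarrow> (x', y) \<in> R \<Longrightarrow> x = x'"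
    using ex_relation_large_rows_singleton_columns[OF assms(1,2,4) AD] by blast
  have "{x \<in> D. R `` {x} \<in> at_least D \<kappa>} \<in> P"
  proof -
    have "A \<subseteq> {x \<in> D. R `` {x} \<in> at_least D \<kappa>}" using R(2) AD by blast
    then show ?thesis using A P(2) unfolding upward_monotone_def by blast
  qed
  moreover have RD: "R \<subseteq> D \<times> D" using R(1) AD by blast
  ultimately have "R\<inverse> \<in> iteration D (at_least D \<kappa>) P"
    using dom unfolding dominates_def iteration_def by blast
  then have "\<kappa> \<le>o |{y \<in> D. R\<inverse> `` {y} \<in> P}|"
    unfolding iteration_def at_least_def by simp
  with assms(3) have "|{()}| \<le>o |{y \<in> D. R\<inverse> `` {y} \<in> P}|"
    by (rule ordLeq_transitive)
  then obtain y where y: "R\<inverse> `` {y} \<in> P"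
    unfolding card_of_ordLeq[symmetric] by blast
  then have "R\<inverse> `` {y} \<noteq> {}" using P(3) by metis
  then obtain x where x: "(x, y) \<in> R" by blast
  then have "R\<inverse> `` {y} = {x}" using uniq by blast
  then show ?thesis using x y R(1) by auto
qed

lemma eq_exists_in_if_singletons:
  assumes "quantifier_on D P" "upward_monotone D P" "\<And>A. A \<in> P \<Longrightarrow> \<exists>x\<in>A. {x} \<in> P"
  shows "P = exists_in D {x \<in> D. {x} \<in> P}"
proof
  show "P \<subseteq> exists_in D {x \<in> D. {x} \<in> P}"
    using assms(1,3) unfolding quantifier_on_def exists_in_def by blast
  show "exists_in D {x \<in> D. {x} \<in> P} \<subseteq> P"
  proof
    fix B assume "B \<in> exists_in D {x \<in> D. {x} \<in> P}"
    then obtain x where "{x} \<in> P" "{x} \<subseteq> B" "B \<subseteq> D" unfolding exists_in_def by blast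
    then show "B \<in> P" using assms(2) unfolding upward_monotone_def by blast
  qed
qed

theorem proposition4p6:
  fixes D :: "'a set" and \<kappa> :: "'b rel" and P :: "'a set set"
  assumes "infinite D"
    and "Card_order \<kappa>"
    and "|{()}| \<le>o \<kappa>"
    and "\<kappa> \<le>o |D|"
    and "quantifier_on D P"
    and "upward_monotone D P"
    and "proper_quantifier D P"
  shows "(dominates D P (at_least D \<kappa>) \<longleftrightarrow>
            (\<exists>S. S \<subseteq> D \<and> S \<noteq> {} \<and> P = exists_in D S))
       \<and> (dominates D P (at_least D \<kappa>) \<longrightarrow>
            iteration D P (at_least D \<kappa>) = branching_product D P (at_least D \<kappa>))"
proof -
  have proper: "{} \<notin> P" "D \<in> P" using assms(7) unfolding proper_quantifier_def by auto
  have ex: "\<exists>S. S \<subseteq> D \<and> S \<noteq> {} \<and> P = exists_in D S"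
    if dom: "dominates D P (at_least D \<kappa>)"
  proof (intro exI conjI)
    have sing: "\<exists>x\<in>A. {x} \<in> P" if "A \<in> P" for A
      using ex_singleton_in_if_dominates_at_least[OF assms(1-6) proper(1) dom that] .
    show "{x \<in> D. {x} \<in> P} \<subseteq> D" by simp
    show "{x \<in> D. {x} \<in> P} \<noteq> {}" using sing[OF proper(2)] by blast
    show "P = exists_in D {x \<in> D. {x} \<in> P}"
      using assms(5,6) sing by (rule eq_exists_in_if_singletons)
  qed
  have dom: "dominates D P (at_least D \<kappa>)" if "P = exists_in D S" for S
    unfolding that by (rule exists_in_dominates[OF upward_monotone_at_least])
  have eq: "iteration D P (at_least D \<kappa>) = branching_product D P (at_least D \<kappa>)"
    if "P = exists_in D S" for S
    unfolding that by (rule iteration_exists_in_eq_branching_product[OF upward_monotone_at_least])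
  show ?thesis
  proof (intro conjI iffI impI)
    assume "dominates D P (at_least D \<kappa>)"
    from ex[OF this] show "\<exists>S. S \<subseteq> D \<and> S \<noteq> {} \<and> P = exists_in D S" .
  next
    assume "\<exists>S. S \<subseteq> D \<and> S \<noteq> {} \<and> P = exists_in D S"
    then show "dominates D P (at_least D \<kappa>)" by (elim exE conjE) (rule dom)
  next
    assume "dominates D P (at_least D \<kappa>)"
    from ex[OF this] show "iteration D P (at_least D \<kappa>) = branching_product D P (at_least D \<kappa>)"
      by (elim exE conjE) (rule eq)
  qed
qed

end
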